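(* Let $(D,B_0)$ be an infinite dimaze (i.e. $V(D)$ is infinite) that does not contain any alternating comb. Then the matroid $M_L(D,B_0)$ is not infinitely connected.
   Context: Matroids (possibly infinite, in the sense of Bruhn et al.): for a set $E$ and $\mathcal I\subseteq 2^E$, let $\mathcal I^{\max}$ be the set of inclusion-maximal elements of $\mathcal I$. The pair $(E,\mathcal I)$ is a matroid if: (I1) $\emptyset\in\mathcal I$; (I2) if $I\subseteq I'$ and $I'\in\mathcal I$ then $I\in\mathcal I$; (I3) for all $I\in\mathcal I\setminus\mathcal I^{\max}$ and $I'\in\mathcal I^{\max}$ there is $x\in I'\setminus I$ with $I\cup\{x\}\in\mathcal I$; (IM) whenever $I\in\mathcal I$ and $I\subseteq X\subseteq E$, the set $\{I'\in\mathcal I: I\subseteq I'\subseteq X\}$ has a maximal element. Bases are the elements of $\mathcal I^{\max}$. For a matroid $M$ on $E$ and $Y\subseteq E$, $M\setminus Y$ is the matroid on $E\setminus Y$ whose independent sets are the independent sets of $M$ contained in $E\setminus Y$. Connectivity (Bruhn and Wollan): for an integer $k\ge 0$, a $k$-separation of a matroid $M$ on $E$ is a partition of $E$ into $X$ and $Y$ such that $|X|,|Y|\ge k$ and, for any pair of bases $B_X$ of $M\setminus Y$ and $B_Y$ of $M\setminus X$, the number of elements to be deleted from $B_X\cup B_Y$ to get a base of $M$ is less than $k$ (this number is known not to depend on the choice of $B_X$, $B_Y$ or the deleted set). A matroid is infinitely connected if it has no $k$-separation for any integer $k$. Dimazes: a dimaze is a pair $(D,B_0)$ where $D$ is a digraph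 (of arbitrary cardinality) and $B_0$ is a subset of the set of vertices of $D$ of out-degree $0$; the elements of $B_0$ are called exits. A linkage is a set $\mathcal P$ of pairwise (vertex-)disjoint finite directed paths (possibly trivial, i.e. consisting of a single vertex) in $D$, each of whose terminal vertices lies in $B_0$. A set $I\subseteq V(D)$ is linkable (or independent) if there is a linkage $\mathcal P$ such that the set of initial vertices of paths in $\mathcal P$ is exactly $I$. $M_L(D,B_0)$ denotes the pair consisting of $V(D)$ and the family of all linkable subsets of $V(D)$; it is known to be a matroid whenever $(D,B_0)$ contains no alternating comb. Alternating combs: an alternating ray is a digraph whose underlying graph is a ray (a one-way infinite path) and which has infinitely many vertices of in-degree $2$. An alternating comb is a dimaze constructed from an alternating ray by linking all its vertices of in-degree $2$ together with its first vertex onto a set of exits by (possibly trivial) pairwise disjoint directed paths which meet the ray exactly at their initial vertices. A dimaze $(D,B_0)$ contains an alternating comb if $D$ contains the digraph of some alternating comb as a subdigraph and $B_0$ contains the exits of that alternating comb. *)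

theory Defs
  imports "Graph_Theory.Graph_Theory"
begin

section \<open>Set systems and connectivity\<close>

text \<open>
  A matroid is given by its ground set and its family of independent sets. The notions below are
  defined for arbitrary such pairs; they carry their usual meaning when the pair is a
  (possibly infinite) matroid.
\<close>

type_synonym 'a set_system = "'a set \<times> 'a set set"

definition ground :: "'a set_system \<Rightarrow> 'a set" where
  "ground M = fst M"

definition indeps :: "'a set_system \<Rightarrow> 'a set set" where
  "indeps M = snd M"

definition bases :: "'a set_system \<Rightarrow> 'a set set" where
  "bases M = {B \<in> indeps M. \<forall>I \<in> indeps M. B \<subseteq> I \<longrightarrow> I = B}"

definition deletion :: "'a set_system \<Rightarrow> 'a set \<Rightarrow> 'a set_system" where
  "deletion M Y = (ground M - Y, {I \<in> indeps M. I \<subseteq> ground M - Y})"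

text \<open>
  \<open>F\<close> is the set of elements deleted from \<open>BX \<union> BY\<close> in order to get a base. In a matroid such a
  set exists and its size depends neither on \<open>BX\<close> and \<open>BY\<close> nor on the choice of \<open>F\<close>. Since
  \<open>card\<close> vanishes on infinite sets, infinite sets are treated explicitly.
\<close>

definition k_separation :: "'a set_system \<Rightarrow> nat \<Rightarrow> 'a set \<Rightarrow> 'a set \<Rightarrow> bool" where
  "k_separation M k X Y \<longleftrightarrow>
     X \<union> Y = ground M \<and> X \<inter> Y = {} \<and>
     (infinite X \<or> k \<le> card X) \<and> (infinite Y \<or> k \<le> card Y) \<and>
     (\<forall>BX \<in> bases (deletion M Y). \<forall>BY \<in> bases (deletion M X).
        \<exists>F \<subseteq> BX \<union> BY. finite F \<and> card F < k \<and> (BX \<union> BY) - F \<in> bases M)"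

definition infinitely_connected :: "'a set_system \<Rightarrow> bool" where
  "infinitely_connected M \<longleftrightarrow> \<not> (\<exists>k X Y. k_separation M k X Y)"


section \<open>Dimazes\<close>

text \<open>
  Out-degree zero is expressed by \<^const>\<open>out_arcs\<close>, because \<^const>\<open>out_degree\<close> is also zero at
  vertices with infinitely many outgoing arcs.
\<close>

definition dimaze :: "('a, 'b) pre_digraph \<Rightarrow> 'a set \<Rightarrow> bool" where
  "dimaze D B0 \<longleftrightarrow> wf_digraph D \<and> B0 \<subseteq> {v \<in> verts D. out_arcs D v = {}}"

text \<open>
  Directed paths are represented by their nonempty, repetition-free vertex lists.
\<close>

definition linkage :: "('a, 'b) pre_digraph \<Rightarrow> 'a set \<Rightarrow> 'a list set \<Rightarrow> bool" where
  "linkage D B0 P \<longleftrightarrow>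
     (\<forall>p \<in> P. vpath p D \<and> last p \<in> B0) \<and>
     (\<forall>p \<in> P. \<forall>q \<in> P. p \<noteq> q \<longrightarrow> set p \<inter> set q = {})"

definition linkable :: "('a, 'b) pre_digraph \<Rightarrow> 'a set \<Rightarrow> 'a set \<Rightarrow> bool" where
  "linkable D B0 I \<longleftrightarrow> (\<exists>P. linkage D B0 P \<and> hd ` P = I)"

definition M_L :: "('a, 'b) pre_digraph \<Rightarrow> 'a set \<Rightarrow> 'a set_system" where
  "M_L D B0 = (verts D, {I. I \<subseteq> verts D \<and> linkable D B0 I})"


section \<open>Alternating combs\<close>

text \<open>
  The underlying graph of \<open>R\<close> is the ray \<open>r 0, r 1, \<dots>\<close>: the vertices \<open>r n\<close> are distinct, and there
  is exactly one arc, \<open>e n\<close>, between \<open>r n\<close> and \<open>r (Suc n)\<close> (in either direction), and no other arc.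
\<close>

definition alternating_ray :: "('a, 'b) pre_digraph \<Rightarrow> (nat \<Rightarrow> 'a) \<Rightarrow> bool" where
  "alternating_ray R r \<longleftrightarrow>
     wf_digraph R \<and> bij_betw r UNIV (verts R) \<and>
     (\<exists>e. bij_betw e UNIV (arcs R) \<and>
          (\<forall>n. {tail R (e n), head R (e n)} = {r n, r (Suc n)})) \<and>
     infinite {v \<in> verts R. in_degree R v = 2}"

text \<open>
  The dimaze \<open>(C, X)\<close> consists of an alternating ray \<open>R\<close> and the linking paths \<open>Q\<close>, and nothing
  else. The ray and the paths have no parallel arcs, and two of them share at most one vertex;
  hence \<open>C\<close> has no parallel arcs either, and its arcs are determined by their end vertices.
\<close>

definition alternating_comb :: "('a, 'b) pre_digraph \<Rightarrow> 'a set \<Rightarrow> bool" where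
  "alternating_comb C X \<longleftrightarrow> dimaze C X \<and> nomulti_digraph C \<and>
     (\<exists>R r Q. alternating_ray R r \<and> subgraph R C \<and> linkage C X Q \<and>
        hd ` Q = insert (r 0) {v \<in> verts R. in_degree R v = 2} \<and>
        last ` Q = X \<and>
        (\<forall>p \<in> Q. set p \<inter> verts R = {hd p}) \<and>
        verts C = verts R \<union> (\<Union>p \<in> Q. set p) \<and>
        arcs_ends C = arcs_ends R \<union> (\<Union>p \<in> Q. set (vwalk_arcs p)))"

definition contains_alternating_comb :: "('a, 'b) pre_digraph \<Rightarrow> 'a set \<Rightarrow> bool" where
  "contains_alternating_comb D B0 \<longleftrightarrow>
     (\<exists>C X. alternating_comb C X \<and> subgraph C D \<and> X \<subseteq> B0)"

end

theory Submission
  imports Defs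
begin

text \<open>
  A finite set \<open>G\<close> that is not linkable, or that meets every base, gives a \<open>card G\<close>-separation
  with its complement. So in an infinitely connected matroid every finite set is linkable and
  avoided by some base, and this suffices to build an alternating comb greedily.
  Finite sets being linkable, no finite set separates a nonexit from the exits; finite sets being
  avoided by bases, any finitely many exits are the ends of disjoint paths starting outside a
  given finite set. Given a finite piece of the comb with last vertex \<open>v\<close>, take a path from \<open>v\<close> to
  an exit avoiding the piece and an arc \<open>(u, y)\<close> into it from a new vertex \<open>u\<close>: the valley \<open>y\<close> is
  linked by the rest of the path, and the construction continues from \<open>u\<close>.

  The separation needs the transitivity of spanning in the possibly non-finitary system
  \<open>M_L D B0\<close>. It is derived from an exchange property that alternating walks yield in every
  dimaze.
\<close>

section \<open>Linkages as routings\<close>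

lemma set_vwalk_arcs: "set (vwalk_arcs p) = {(p ! i, p ! Suc i) | i. Suc i < length p}"
proof (induction p rule: vwalk_arcs.induct)
  case (3 x y xs)
  have "{((x # y # xs) ! i, (x # y # xs) ! Suc i) | i. Suc i < length (x # y # xs)} =
      insert (x, y) {((y # xs) ! i, (y # xs) ! Suc i) | i. Suc i < length (y # xs)}"
    (is "?A = insert _ ?B")
  proof (intro set_eqI iffI)
    fix a assume "a \<in> ?A"
    then obtain i where "a = ((x # y # xs) ! i, (x # y # xs) ! Suc i)" "Suc i < length (x # y # xs)"
      by blast
    then show "a \<in> insert (x, y) ?B"
      by (cases i) auto
  next
    fix a assume "a \<in> insert (x, y) ?B"
    then consider "a = (x, y)"
      | i where "a = ((y # xs) ! i, (y # xs) ! Suc i)" "Suc i < length (y # xs)"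
      by blast
    then show "a \<in> ?A"
    proof cases
      case 1
      then show ?thesis by (intro CollectI exI[of _ 0]) auto
    next
      case 2
      then show ?thesis by (intro CollectI exI[of _ "Suc i"]) auto
    qed
  qed
  with 3 show ?case by simp
qed auto

section \<open>Dimazes, linkages and their encoding by maps\<close>

locale sink_dimaze =
  fixes D :: "('a, 'b) pre_digraph" and B0 :: "'a set"
  assumes dimaze: "dimaze D B0"
begin

text \<open>Vertices of out-degree zero outside \<open>B0\<close> are inner as well; having no
  outgoing arc, they can only be fixed by a routing.\<close>

abbreviation inner :: "'a set" where
  "inner \<equiv> verts D - B0"

lemma wf: "wf_digraph D"
  using dimaze by (simp add: dimaze_def)

lemma exits_subset: "B0 \<subseteq> verts D"
  using dimaze by (auto simp: dimaze_def)

lemma arc_verts: "(u, v) \<in> arcs_ends D \<Longrightarrow> u \<in> inner \<and> v \<in> verts D"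
  using dimaze wf by (force simp: dimaze_def arcs_ends_conv out_arcs_def wf_digraph_def)

lemma linkageD:
  assumes "linkage D B0 P" "p \<in> P"
  shows "p \<noteq> []" "distinct p" "set p \<subseteq> verts D" "last p \<in> B0"
    "\<And>i. Suc i < length p \<Longrightarrow> (p ! i, p ! Suc i) \<in> arcs_ends D"
  using assms by (auto simp: linkage_def vpath_def vwalk_def set_vwalk_arcs)

lemma linkage_disjoint:
  assumes "linkage D B0 P" "p \<in> P" "q \<in> P" "v \<in> set p" "v \<in> set q"
  shows "p = q"
  using assms by (auto simp: linkage_def)

lemma linkable_subset_verts: "linkable D B0 I \<Longrightarrow> I \<subseteq> verts D"
  unfolding linkable_def using linkageD(1,3) by fastforce

lemma linkable_mono:
  assumes "linkable D B0 I" "J \<subseteq> I"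
  shows "linkable D B0 J"
proof -
  obtain P where P: "linkage D B0 P" "hd ` P = I"
    using assms by (auto simp: linkable_def)
  have "linkage D B0 {p \<in> P. hd p \<in> J}"
    using P(1) by (simp add: linkage_def)
  moreover have "hd ` {p \<in> P. hd p \<in> J} = J"
    using P(2) assms(2) by auto
  ultimately show ?thesis by (auto simp: linkable_def)
qed

text \<open>
  A linkage is encoded by the map sending each nonexit on one of its paths to the next vertex and
  fixing all other nonexits. As a matching between left copies of the nonexits and right copies of
  all vertices, such a map can be rerouted along alternating walks; the initial vertices are among
  the right copies it misses.
\<close>

definition routing :: "('a \<Rightarrow> 'a) \<Rightarrow> bool" where
  "routing f \<longleftrightarrow> inj_on f inner \<and> (\<forall>v \<in> inner. f v = v \<or> (v, f v) \<in> arcs_ends D) \<and>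
     \<not> (\<exists>x. inj x \<and> (\<forall>n. x n \<in> inner \<and> x (Suc n) = f (x n)))"

text \<open>By injectivity of \<open>f\<close>, equal points of two orbits can be pulled back step
  by step. When one orbit is back at its start, that vertex is no image of \<open>f\<close>, so the
  other is at its start too. This yields both distinctness within a path and disjointness of
  different paths.\<close>

lemma orbit_unique:
  assumes "inj_on f inner" "a \<in> verts D - f ` inner" "b \<in> verts D - f ` inner"
    and "\<And>i. i < m \<Longrightarrow> (f ^^ i) a \<in> inner" "\<And>i. i < n \<Longrightarrow> (f ^^ i) b \<in> inner"
    and "(f ^^ m) a = (f ^^ n) b"
  shows "m = n \<and> a = b"
  using assms(4-)
proof (induction m arbitrary: n)
  case 0
  show ?case
  proof (cases n)
    case (Suc n')
    then have "a \<in> f ` inner" using 0 by auto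
    then show ?thesis using assms(2) by blast
  qed (use 0 in auto)
next
  case (Suc m)
  show ?case
  proof (cases n)
    case 0
    then have "b \<in> f ` inner" using Suc.prems(1)[of m] Suc.prems(3) by auto
    then show ?thesis using assms(3) by blast
  next
    case (Suc n')
    have "(f ^^ m) a = (f ^^ n') b"
      using inj_onD[OF assms(1), of "(f ^^ m) a" "(f ^^ n') b"] Suc.prems Suc by auto
    then show ?thesis
      using Suc.IH[of n'] Suc.prems Suc by auto
  qed
qed

text \<open>An orbit that starts at a missed vertex and never meets \<open>B0\<close> stays in
  \<open>inner\<close> and is injective by \<open>orbit_unique\<close>; such rays are ruled out by
  the last clause of \<open>routing\<close>.\<close>

lemma orbit_reaches_exit:
  assumes f: "routing f" and a: "a \<in> verts D - f ` inner"
  obtains n where "(f ^^ n) a \<in> B0" "\<And>i. i < n \<Longrightarrow> (f ^^ i) a \<in> inner"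
proof -
  have verts: "(f ^^ n) a \<in> verts D" if "\<And>i. i < n \<Longrightarrow> (f ^^ i) a \<in> inner" for n
  proof (cases n)
    case (Suc m)
    then have "(f ^^ m) a \<in> inner" using that by blast
    then have "f ((f ^^ m) a) \<in> verts D"
      using f arc_verts unfolding routing_def by (metis DiffD1)
    then show ?thesis using Suc by simp
  qed (use a in simp)
  have "\<exists>n. (f ^^ n) a \<in> B0"
  proof (rule ccontr)
    assume *: "\<nexists>n. (f ^^ n) a \<in> B0"
    have inner: "(f ^^ n) a \<in> inner" for n
      by (induction n rule: less_induct) (use * verts in blast)
    then have "inj (\<lambda>n. (f ^^ n) a)"
      using orbit_unique[OF _ a a] f by (auto simp: inj_def routing_def)
    then have "\<exists>x. inj x \<and> (\<forall>n. x n \<in> inner \<and> x (Suc n) = f (x n))"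
      using inner by (intro exI[of _ "\<lambda>n. (f ^^ n) a"]) auto
    then show False
      using f unfolding routing_def by blast
  qed
  then obtain n where n: "(f ^^ n) a \<in> B0" "\<And>i. i < n \<Longrightarrow> (f ^^ i) a \<notin> B0"
    using exists_least_iff[of "\<lambda>n. (f ^^ n) a \<in> B0"] by blast
  have "(f ^^ i) a \<in> inner" if "i < n" for i
    using that by (induction i rule: less_induct) (use n verts in auto)
  with n show thesis using that by blast
qed

text \<open>The linkage consists of the orbits of the vertices of \<open>I\<close>, each cut off at
  its first exit.\<close>

lemma linkable_of_routing:
  assumes f: "routing f" and I: "I \<subseteq> verts D" "I \<inter> f ` inner = {}"
  shows "linkable D B0 I"
proof -
  have "\<forall>a \<in> I. \<exists>n. (f ^^ n) a \<in> B0 \<and> (\<forall>i < n. (f ^^ i) a \<in> inner)"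
  proof
    fix a assume "a \<in> I"
    then have "a \<in> verts D - f ` inner" using I by auto
    then obtain n where "(f ^^ n) a \<in> B0" "\<And>i. i < n \<Longrightarrow> (f ^^ i) a \<in> inner"
      using orbit_reaches_exit[OF f] by blast
    then show "\<exists>n. (f ^^ n) a \<in> B0 \<and> (\<forall>i < n. (f ^^ i) a \<in> inner)" by blast
  qed
  then obtain n where n: "\<And>a. a \<in> I \<Longrightarrow> (f ^^ n a) a \<in> B0"
      "\<And>a i. a \<in> I \<Longrightarrow> i < n a \<Longrightarrow> (f ^^ i) a \<in> inner"
    by metis
  have inj: "inj_on f inner"
    using f by (simp add: routing_def)
  have missed: "a \<in> verts D - f ` inner" if "a \<in> I" for a
    using I that by auto
  have uniq: "i = j \<and> a = b"
    if "a \<in> I" "b \<in> I" "i \<le> n a" "j \<le> n b" "(f ^^ i) a = (f ^^ j) b" for a b i j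
    using orbit_unique[OF inj missed[OF that(1)] missed[OF that(2)] _ _ that(5)] n(2) that(1-4)
    by auto
  define path where "path a = map (\<lambda>i. (f ^^ i) a) [0..<Suc (n a)]" for a
  have nth: "path a ! i = (f ^^ i) a" if "i \<le> n a" for a i
    using that by (simp add: path_def del: upt_Suc)
  have len: "length (path a) = Suc (n a)" for a
    by (simp add: path_def)
  have set_path: "set (path a) = {(f ^^ i) a | i. i \<le> n a}" for a
    by (auto simp: path_def simp del: upt_Suc)
  have hd: "hd (path a) = a" for a
    using hd_conv_nth[of "path a"] nth[of 0 a] len[of a] by (metis funpow_0 le0 list.size(3) nat.distinct(1))
  have last: "last (path a) = (f ^^ n a) a" for a
    using last_conv_nth[of "path a"] nth[of "n a" a] len[of a]
    by (metis diff_Suc_1 le_refl list.size(3) nat.distinct(1))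
  have "vpath (path a) D" if a: "a \<in> I" for a
  proof -
    have arc: "((f ^^ i) a, (f ^^ Suc i) a) \<in> arcs_ends D" if "i < n a" for i
    proof -
      \<comment> \<open>A routing may fix vertices, but not on this orbit, where no vertex repeats;
        so each step is an arc.\<close>
      have "(f ^^ Suc i) a \<noteq> (f ^^ i) a"
        using uniq[OF a a, of "Suc i" i] that by auto
      then show ?thesis
        using f n(2)[OF a that] by (auto simp: routing_def)
    qed
    have "(f ^^ i) a \<in> verts D" if "i \<le> n a" for i
      using n[OF a] that exits_subset by (cases "i = n a") auto
    moreover have "distinct (path a)"
      using uniq[OF a a] by (auto simp: path_def distinct_map inj_on_def simp del: upt_Suc)
    moreover have "set (vwalk_arcs (path a)) \<subseteq> arcs_ends D"
      using arc nth[of _ a] by (auto simp: set_vwalk_arcs len)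
    ultimately show ?thesis
      using len[of a] by (auto simp: vpath_def vwalk_def set_path)
  qed
  moreover have "set (path a) \<inter> set (path b) = {}" if "a \<in> I" "b \<in> I" "path a \<noteq> path b" for a b
    using uniq[OF that(1,2)] that(3) by (fastforce simp: set_path)
  ultimately have "linkage D B0 (path ` I)"
    using n(1) by (auto simp: linkage_def last)
  moreover have "hd ` path ` I = I"
    by (force simp: hd)
  ultimately show ?thesis by (auto simp: linkable_def)
qed

text \<open>Following the paths misses their initial vertices: no path step enters one, and an
  initial vertex in \<open>inner\<close> is not fixed, because its path continues beyond it.\<close>

lemma routing_of_linkable:
  assumes "linkable D B0 I"
  obtains f where "routing f" "I \<inter> f ` inner = {}"
proof -
  obtain P where P: "linkage D B0 P" "hd ` P = I"
    using assms by (auto simp: linkable_def)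
  define step where "step = (\<lambda>v w. \<exists>p \<in> P. \<exists>i. Suc i < length p \<and> v = p ! i \<and> w = p ! Suc i)"
  define f where "f v = (if \<exists>w. step v w then SOME w. step v w else v)" for v
  have step_f: "step v (f v)" if "\<exists>w. step v w" for v
    using someI_ex[OF that] that by (simp add: f_def)
  have inner_step: "\<exists>w. step v w" if p: "p \<in> P" "v \<in> set p" "v \<in> inner" for p v
  proof -
    obtain i where i: "i < length p" "v = p ! i"
      using p(2) by (metis in_set_conv_nth)
    have "Suc i \<noteq> length p"
      using linkageD(1,4)[OF P(1) p(1)] p(3) i last_conv_nth[of p]
      by (metis DiffD2 diff_Suc_1)
    then show ?thesis using i p(1) by (auto simp: step_def intro!: bexI[of _ p] exI[of _ i])
  qed
  have nth_eq: "p = q \<and> i = j" if "p \<in> P" "q \<in> P" "i < length p" "j < length q" "p ! i = q ! j"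
    for p q i j
  proof -
    have "p = q"
      using linkage_disjoint[OF P(1) that(1,2), of "p ! i"] that(3-5) nth_mem by metis
    then show ?thesis
      using linkageD(2)[OF P(1) that(1)] that(3-5) by (simp add: nth_eq_iff_index_eq)
  qed
  have step_inj: "v = v'" if "step v w" "step v' w" for v v' w
    using that nth_eq unfolding step_def by (metis Suc_inject)
  have step_verts: "\<exists>p \<in> P. v \<in> set p \<and> w \<in> set p" if "step v w" for v w
    using that unfolding step_def by (metis Suc_lessD nth_mem)
  have fix_off: "v = v'" if "v' \<in> inner" "\<nexists>w. step v' w" "f v = v'" for v v'
  proof (cases "\<exists>w. step v w")
    case True
    then have "step v v'" using step_f that(3) by blast
    then show ?thesis using step_verts inner_step that(1,2) by blast
  next
    case False
    then show ?thesis using that(3) by (simp add: f_def)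
  qed
  have inj: "inj_on f inner"
  proof (rule inj_onI)
    fix v v' assume *: "v \<in> inner" "v' \<in> inner" "f v = f v'"
    consider "\<exists>w. step v w" "\<exists>w. step v' w" | "\<nexists>w. step v' w" | "\<nexists>w. step v w"
      by blast
    then show "v = v'"
    proof cases
      case 1
      then show ?thesis using step_f step_inj *(3) by metis
    next
      case 2
      then have "f v = v'" using *(3) by (simp add: f_def)
      then show ?thesis using fix_off[OF *(2) 2, of v] by simp
    next
      case 3
      then have "f v' = v" using *(3) by (simp add: f_def)
      then show ?thesis using fix_off[OF *(1) 3, of v'] by simp
    qed
  qed
  have step_arc: "(v, w) \<in> arcs_ends D" if "step v w" for v w
    using that linkageD(5)[OF P(1)] by (auto simp: step_def)
  have arc: "f v = v \<or> (v, f v) \<in> arcs_ends D" for v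
    using step_arc[OF step_f] by (cases "\<exists>w. step v w") (auto simp: f_def)
  \<comment> \<open>Consecutive vertices of a ray share a path, so by disjointness the whole ray
    would lie on one finite path.\<close>
  have no_ray: False if x: "inj x" "\<And>n. x n \<in> inner \<and> x (Suc n) = f (x n)" for x
  proof -
    have "step (x n) (x (Suc n))" for n
    proof -
      have "f (x n) \<noteq> x n" using x(1) x(2)[of n] by (metis injD n_not_Suc_n)
      then have "\<exists>w. step (x n) w" unfolding f_def by meson
      then show ?thesis using step_f[of "x n"] x(2)[of n] by auto
    qed
    then have adj: "\<exists>p \<in> P. x n \<in> set p \<and> x (Suc n) \<in> set p" for n
      using step_verts by blast
    obtain p where p: "p \<in> P" "x 0 \<in> set p" using adj by blast
    have "x n \<in> set p" for n
    proof (induction n)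
      case (Suc n)
      then show ?case using adj[of n] linkage_disjoint[OF P(1) p(1)] by metis
    qed (use p in simp)
    then have "finite (range x)"
      by (meson finite_set finite_subset image_subsetI)
    then show False using x(1) finite_imageD infinite_UNIV_nat by blast
  qed
  have "I \<inter> f ` inner = {}"
  proof (rule ccontr)
    assume "I \<inter> f ` inner \<noteq> {}"
    then obtain p v where p: "p \<in> P" "f v = hd p" "v \<in> inner"
      using P(2) by fastforce
    have hd: "hd p = p ! 0" "0 < length p"
      using linkageD(1)[OF P(1) p(1)] by (auto simp: hd_conv_nth)
    have "\<exists>w. step v w"
    proof (rule ccontr)
      assume *: "\<nexists>w. step v w"
      then have "v = hd p" using p(2) by (simp add: f_def)
      then show False using * inner_step[OF p(1) _ p(3)] linkageD(1)[OF P(1) p(1)] by auto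
    qed
    then have "step v (p ! 0)" using step_f p(2) hd(1) by metis
    then show False using nth_eq[OF p(1)] hd(2) unfolding step_def by (metis nat.distinct(1))
  qed
  then show thesis
    using that[of f] inj arc no_ray unfolding routing_def by blast
qed

end

section \<open>Exchange and finite separations\<close>

text \<open>Distinctness matters for rerouting: changing the map at one vertex of the walk must not
  affect its values at the others. A walk returning to an old vertex is cut there.\<close>

lemma rtrancl_distinct_path:
  assumes "(x, y) \<in> r\<^sup>*"
  shows "\<exists>us. us \<noteq> [] \<and> distinct us \<and> hd us = x \<and> last us = y \<and> successively (\<lambda>a b. (a, b) \<in> r) us"
  using assms
proof (induction rule: rtrancl_induct)
  case base
  show ?case by (intro exI[of _ "[x]"]) auto
next
  case (step y z)
  then obtain us where us: "us \<noteq> []" "distinct us" "hd us = x" "last us = y"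
      "successively (\<lambda>a b. (a, b) \<in> r) us"
    by blast
  show ?case
  proof (cases "z \<in> set us")
    case True
    then obtain as bs where "us = as @ z # bs" by (auto simp: in_set_conv_decomp)
    then have split: "us = (as @ [z]) @ bs" by simp
    have "successively (\<lambda>a b. (a, b) \<in> r) (as @ [z])"
      using us(5) unfolding split successively_append_iff by blast
    then show ?thesis
      using us(2,3) split by (intro exI[of _ "as @ [z]"]) (cases as, auto)
  next
    case False
    then show ?thesis
      using us step(2) by (intro exI[of _ "us @ [z]"]) (auto simp: successively_append_iff)
  qed
qed

section \<open>Rerouting along alternating walks and the exchange property\<close>

context sink_dimaze
begin

text \<open>Adjacency of the left copy of \<open>u\<close> and the right copy of \<open>w\<close> in
  the bipartite graph whose matchings the routings are.\<close>

abbreviation stays_or_arc :: "'a \<Rightarrow> 'a \<Rightarrow> bool" where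
  "stays_or_arc u w \<equiv> w = u \<or> (u, w) \<in> arcs_ends D"

text \<open>Changing one value creates no ray: an injective ray passes \<open>u\<close> at most
  once, so some tail of it already follows \<open>f\<close>.\<close>

lemma routing_update:
  assumes f: "routing f" and u: "u \<in> inner" and w: "stays_or_arc u w" "w \<notin> f ` inner"
  shows "routing (f(u := w))" "(f(u := w)) ` inner = insert w (f ` inner - {f u})"
proof -
  have inj: "inj_on f inner" using f by (simp add: routing_def)
  show "(f(u := w)) ` inner = insert w (f ` inner - {f u})"
    using u inj by (auto simp: inj_on_def)
  have "False" if x: "inj x" "\<And>n. x n \<in> inner \<and> x (Suc n) = (f(u := w)) (x n)" for x
  proof -
    obtain m where m: "\<And>n. x (n + m) \<noteq> u"
    proof (cases "\<exists>k. x k = u")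
      case True
      then obtain k where "x k = u" by blast
      then have "x (n + Suc k) \<noteq> u" for n using injD[OF x(1), of "n + Suc k" k] by auto
      then show thesis using that by blast
    qed (use that[of 0] in auto)
    have "inj (\<lambda>n. x (n + m))"
      by (rule injI) (metis add_right_cancel injD x(1))
    moreover have "\<forall>n. x (n + m) \<in> inner \<and> x (Suc n + m) = f (x (n + m))"
      using x(2) m by auto
    ultimately show False
      using f unfolding routing_def by blast
  qed
  moreover have "inj_on (f(u := w)) inner"
    using inj w(2) u by (auto simp: inj_on_def)
  moreover have "\<forall>v \<in> inner. stays_or_arc v ((f(u := w)) v)"
    using f w(1) by (auto simp: routing_def)
  ultimately show "routing (f(u := w))"
    unfolding routing_def by blast
qed

text \<open>The walk is processed from its far end: the last vertex takes the free \<open>w\<close>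
  and releases its old image, which its predecessor takes in turn, until \<open>f (hd us)\<close>
  becomes free.\<close>

lemma routing_alternate:
  assumes "routing f" "us \<noteq> []" "distinct us" "set us \<subseteq> inner"
    and "successively (\<lambda>u u'. stays_or_arc u (f u')) us"
    and "stays_or_arc (last us) w" "w \<notin> f ` inner"
  shows "\<exists>f'. routing f' \<and> f' ` inner = insert w (f ` inner - {f (hd us)})"
  using assms
proof (induction us arbitrary: f w rule: rev_induct)
  case (snoc u us)
  let ?f = "f(u := w)"
  have u: "u \<in> inner" using snoc.prems by simp
  note f = routing_update[OF snoc.prems(1) u, of w]
  have f1: "routing ?f" and im: "?f ` inner = insert w (f ` inner - {f u})"
    using f snoc.prems by auto
  show ?case
  proof (cases "us = []")
    case True
    then show ?thesis using f1 im by (metis append_Nil list.sel(1))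
  next
    case False
    have new: "f u \<notin> ?f ` inner" using im snoc.prems(7) u by auto
    have succ: "successively (\<lambda>u u'. stays_or_arc u (?f u')) us"
    proof -
      have "successively (\<lambda>u u'. stays_or_arc u (f u')) us"
        using snoc.prems(5) by (simp add: successively_append_iff)
      then show ?thesis
        by (rule successively_mono) (use snoc.prems(3) in auto)
    qed
    have "stays_or_arc (last us) (f u)"
      using snoc.prems(5) False by (simp add: successively_append_iff)
    then obtain f' where f': "routing f'" "f' ` inner = insert (f u) (?f ` inner - {?f (hd us)})"
      using snoc.IH[OF f1 False _ _ succ _ new] snoc.prems(3,4) by auto
    have hd: "hd us \<in> inner" "hd us \<noteq> u"
      using False snoc.prems(3,4) by (auto simp: subset_iff)
    then have "f (hd us) \<noteq> f u" "w \<noteq> f (hd us)" "w \<noteq> f u"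
      using snoc.prems(1,7) u by (auto simp: routing_def inj_on_def)
    then have "f' ` inner = insert w (f ` inner - {f (hd us)})"
      using f'(2) im hd u by auto
    then show ?thesis using f'(1) False by auto
  qed
qed simp

text \<open>
  Let \<open>A\<close> be the set of all \<open>y\<close> in the conclusion, let \<open>f\<close> route \<open>I\<close> and let \<open>U\<close> be the set of nonexits reachable from \<open>c\<close> by alternating
  walks. A routing \<open>g\<close> of \<open>insert c A\<close> maps \<open>U\<close> into the right copies reachable by alternating
  walks, all of which except those in \<open>A\<close> are images under \<open>f\<close> of elements of \<open>U\<close>. Following \<open>g\<close>
  on \<open>U\<close> and \<open>f\<close> elsewhere would therefore route \<open>insert c I\<close>.
\<close>
lemma linkable_exchange:
  assumes I: "linkable D B0 I" and c: "c \<in> verts D" and dep: "\<not> linkable D B0 (insert c I)"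
  shows "\<not> linkable D B0 (insert c {y \<in> I. linkable D B0 (insert c (I - {y}))})"
    (is "\<not> linkable D B0 (insert c ?A)")
proof
  assume "linkable D B0 (insert c ?A)"
  then obtain g where g: "routing g" "insert c ?A \<inter> g ` inner = {}"
    by (rule routing_of_linkable)
  obtain f where f: "routing f" "I \<inter> f ` inner = {}"
    using I by (rule routing_of_linkable)
  have IV: "I \<subseteq> verts D" by (rule linkable_subset_verts[OF I])
  \<comment> \<open>Otherwise \<open>f\<close> itself would route \<open>insert c I\<close>.\<close>
  have "c \<in> f ` inner"
    using linkable_of_routing[OF f(1), of "insert c I"] f(2) IV c dep by auto
  then obtain u0 where u0: "u0 \<in> inner" "f u0 = c" by auto
  define r where "r = {(u, u'). u \<in> inner \<and> u' \<in> inner \<and> stays_or_arc u (f u')}"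
  define U where "U = {u. (u0, u) \<in> r\<^sup>*}"
  have U_inner: "u \<in> inner" if "u \<in> U" for u
  proof -
    have "(u0, u) \<in> r\<^sup>*" using that by (simp add: U_def)
    then show ?thesis by (induction rule: rtrancl_induct) (use u0 in \<open>auto simp: r_def\<close>)
  qed
  have U_step: "v \<in> U" if "u \<in> U" "v \<in> inner" "stays_or_arc u (f v)" for u v
    using that U_inner[OF that(1)] unfolding U_def r_def by (auto intro: rtrancl_into_rtrancl)
  \<comment> \<open>Rerouting along a walk from \<open>u0\<close> to \<open>u\<close> and on to
    \<open>w\<close> releases \<open>c\<close> and covers only \<open>w\<close> instead. As
    \<open>insert c I\<close> is not linkable, \<open>w\<close> must lie in \<open>I\<close>, and it
    can be exchanged for \<open>c\<close>.\<close>
  have missed: "w \<in> ?A" if u: "u \<in> U" and w: "stays_or_arc u w" "w \<notin> f ` inner" for u w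
  proof -
    obtain us where us: "us \<noteq> []" "distinct us" "hd us = u0" "last us = u"
        "successively (\<lambda>a b. (a, b) \<in> r) us"
      using rtrancl_distinct_path[of u0 u r] u by (auto simp: U_def)
    have "set us \<subseteq> inner"
    proof
      fix v assume "v \<in> set us"
      then obtain as bs where split: "us = as @ v # bs" by (auto simp: in_set_conv_decomp)
      show "v \<in> inner"
      proof (cases as rule: rev_cases)
        case Nil
        then show ?thesis using split us(3) u0 by simp
      next
        case (snoc as' a)
        then show ?thesis using split us(5) by (auto simp: successively_append_iff r_def)
      qed
    qed
    moreover have "successively (\<lambda>u u'. stays_or_arc u (f u')) us"
      by (rule successively_mono[OF us(5)]) (auto simp: r_def)
    ultimately obtain f' where f': "routing f'" "f' ` inner = insert w (f ` inner - {c})"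
      using routing_alternate[OF f(1) us(1,2) _ _ _ w(2)] w(1) us(3,4) u0(2) by auto
    have cI: "c \<notin> I" using f(2) u0 by blast
    have "w \<in> I"
    proof (rule ccontr)
      assume "w \<notin> I"
      then have "insert c I \<inter> f' ` inner = {}"
        using f' f(2) cI u0 w(2) by auto
      then show False
        using linkable_of_routing[OF f'(1), of "insert c I"] dep c IV by auto
    qed
    moreover have "linkable D B0 (insert c (I - {w}))"
      using linkable_of_routing[OF f'(1), of "insert c (I - {w})"] f' f(2) cI u0 w(2) c IV by auto
    ultimately show ?thesis by simp
  qed
  define h where "h v = (if v \<in> U then g v else f v)" for v
  have inj: "inj_on f inner" "inj_on g inner"
    using f(1) g(1) by (auto simp: routing_def)
  have choice: "stays_or_arc v (f v)" "stays_or_arc v (g v)" if "v \<in> inner" for v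
    using f(1) g(1) that by (auto simp: routing_def)
  \<comment> \<open>If \<open>f v\<close> equalled \<open>g u\<close>, the alternating walk could be
    continued from \<open>u\<close> to \<open>v\<close>, putting \<open>v\<close> into
    \<open>U\<close>.\<close>
  have separate: "g u \<noteq> f v" if "u \<in> U" "v \<in> inner" "v \<notin> U" for u v
    using U_step[of u v] choice(2)[OF U_inner[of u]] that by metis
  have "inj_on h inner"
    using inj separate separate[symmetric] U_inner by (auto simp: inj_on_def h_def)
  moreover have "\<forall>v \<in> inner. stays_or_arc v (h v)"
    using choice by (auto simp: h_def)
  moreover have False if x: "inj x" "\<And>n. x n \<in> inner \<and> x (Suc n) = h (x n)" for x
  proof (cases "\<forall>n. x n \<in> U")
    case True
    then have "\<forall>n. x n \<in> inner \<and> x (Suc n) = g (x n)" using x(2) by (simp add: h_def)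
    then show False using g(1) x(1) unfolding routing_def by blast
  next
    case False
    then obtain m where m: "x m \<notin> U" by blast
    \<comment> \<open>A ray of \<open>h\<close> cannot enter \<open>U\<close> from outside: if
      \<open>f v\<close> is in \<open>U\<close>, then staying at \<open>f v\<close> on the right
      side is an alternating step to \<open>v\<close>. So the ray eventually follows
      \<open>f\<close>.\<close>
    have off: "x (n + m) \<notin> U" for n
    proof (induction n)
      case (Suc n)
      then have "x (Suc n + m) = f (x (n + m))" using x(2)[of "n + m"] by (simp add: h_def)
      then show ?case using Suc U_step[of "x (Suc n + m)" "x (n + m)"] x(2)[of "n + m"] by auto
    qed (use m in simp)
    have "inj (\<lambda>n. x (n + m))"
      by (rule injI) (metis add_right_cancel injD x(1))
    moreover have "\<forall>n. x (n + m) \<in> inner \<and> x (Suc n + m) = f (x (n + m))"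
      using x(2) off by (simp add: h_def)
    ultimately show False
      using f(1) unfolding routing_def by blast
  qed
  ultimately have "routing h"
    unfolding routing_def by blast
  moreover have "insert c I \<inter> h ` inner = {}"
  proof -
    \<comment> \<open>On \<open>U\<close>, the value \<open>g v\<close> is an image of
      \<open>f\<close>, since otherwise \<open>missed\<close> would put it into \<open>?A\<close>,
      which \<open>g\<close> avoids; hence it is not in \<open>I\<close>. Off \<open>U\<close>, only
      \<open>c\<close> needs care, and its unique preimage \<open>u0\<close> lies in
      \<open>U\<close>.\<close>
    have "a \<noteq> h v" if a: "a \<in> insert c I" and v: "v \<in> inner" for a v
    proof (cases "v \<in> U")
      case True
      have "a \<notin> g ` inner" if "a = c \<or> a \<in> ?A" using g(2) that by blast
      then show ?thesis
        using missed[OF True choice(2)[OF v]] f(2) a v True by (auto simp: h_def)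
    next
      case False
      have "u0 \<in> U" by (simp add: U_def)
      then have "f v \<noteq> c" using inj_onD[OF inj(1), of v u0] u0 v False by metis
      then show ?thesis using f(2) a v False by (auto simp: h_def)
    qed
    then show ?thesis by blast
  qed
  ultimately have "linkable D B0 (insert c I)"
    using linkable_of_routing c IV by simp
  then show False using dep by contradiction
qed

text \<open>Replacing \<open>y\<close> by \<open>c\<close> keeps \<open>c'\<close> spanned. If the
  enlarged set were linkable, neither \<open>c\<close> nor \<open>c'\<close> could be exchanged for
  \<open>y\<close>, as this would leave \<open>insert c' T\<close> or \<open>insert c T\<close>. All
  exchangeable elements together with \<open>y\<close> would then lie in the linkable set
  \<open>T\<close>, against \<open>linkable_exchange\<close>.\<close>

lemma not_linkable_swap:
  assumes T: "linkable D B0 T" "y \<in> T"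
    and c: "\<not> linkable D B0 (insert c T)" "\<not> linkable D B0 (insert c' T)" "c \<noteq> c'"
  shows "\<not> linkable D B0 (insert c' (insert c (T - {y})))"
proof
  let ?I = "insert c' (insert c (T - {y}))"
  assume I: "linkable D B0 ?I"
  have notin: "c \<notin> T" "c' \<notin> T"
    using c T(1) by (auto simp: insert_absorb)
  have "insert y ?I = insert c' (insert c T)" using T(2) by blast
  then have "\<not> linkable D B0 (insert y ?I)"
    using c(1) linkable_mono by (metis subset_insertI)
  then have *: "\<not> linkable D B0 (insert y {w \<in> ?I. linkable D B0 (insert y (?I - {w}))})"
    using linkable_exchange[OF I] linkable_subset_verts[OF T(1)] T(2) by blast
  have "insert y (?I - {c}) = insert c' T" "insert y (?I - {c'}) = insert c T"
    using T(2) notin c(3) by blast+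
  then have "insert y {w \<in> ?I. linkable D B0 (insert y (?I - {w}))} \<subseteq> T"
    using c(1,2) T(2) by auto
  then show False using * linkable_mono[OF T(1)] by blast
qed

text \<open>Transitivity of spanning for a finite independent \<open>C\<close>, in contrapositive
  form: if \<open>T\<close> spans \<open>C\<close> but not \<open>z\<close>, then \<open>C\<close>
  does not span \<open>z\<close>. Elements of \<open>C\<close> are swapped into \<open>T\<close> one
  at a time, keeping \<open>insert z T\<close> linkable, until \<open>T\<close> contains
  \<open>C\<close>.\<close>

lemma linkable_insert_of_spanned:
  assumes "finite C" "linkable D B0 C" "linkable D B0 T" "linkable D B0 (insert z T)" "z \<notin> T"
    and "\<And>c. c \<in> C - T \<Longrightarrow> \<not> linkable D B0 (insert c T)"
  shows "linkable D B0 (insert z C)"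
  using assms
proof (induction "card (C - T)" arbitrary: T rule: less_induct)
  case (less T)
  show ?case
  proof (cases "C \<subseteq> T")
    case True
    then show ?thesis using linkable_mono[OF less.prems(4)] by blast
  next
    case False
    then obtain c where c: "c \<in> C" "c \<notin> T" by blast
    have dep: "\<not> linkable D B0 (insert c T)" using less.prems(6) c by blast
    \<comment> \<open>The candidates to be swapped out for \<open>c\<close>. Since
      \<open>insert c A\<close> is not linkable while \<open>C\<close> is, some candidate lies
      outside \<open>C\<close>, so the swap makes \<open>C - T\<close> smaller.\<close>
    define A where "A = {y \<in> insert z T. linkable D B0 (insert c (insert z T - {y}))}"
    have "\<not> linkable D B0 (insert c (insert z T))"
      using dep linkable_mono by (metis insert_mono subset_insertI)
    then have "\<not> linkable D B0 (insert c A)"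
      using linkable_exchange[OF less.prems(4)] linkable_subset_verts[OF less.prems(2)] c(1)
      unfolding A_def by blast
    then have "\<not> A \<subseteq> C"
      using linkable_mono[OF less.prems(2)] c(1) by blast
    then obtain y where y: "y \<in> A" "y \<notin> C" by blast
    have "y \<noteq> z"
    proof
      assume "y = z"
      moreover have "insert z T - {z} = T" using less.prems(5) by blast
      ultimately show False using y(1) dep by (simp add: A_def)
    qed
    then have yT: "y \<in> T" using y(1) by (simp add: A_def)
    let ?T = "insert c (T - {y})"
    have "c \<noteq> z" using dep less.prems(4) by blast
    then have z: "z \<notin> ?T" using less.prems(5) by blast
    have "insert z ?T = insert c (insert z T - {y})" using \<open>y \<noteq> z\<close> by blast
    then have Tz: "linkable D B0 (insert z ?T)" using y(1) by (simp add: A_def)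
    then have T: "linkable D B0 ?T" using linkable_mono by blast
    have spanned: "\<not> linkable D B0 (insert c' ?T)" if "c' \<in> C - ?T" for c'
    proof -
      have "c' \<in> C - T" "c' \<noteq> c" using that y(2) by auto
      then show ?thesis using not_linkable_swap[OF less.prems(3) yT dep] less.prems(6) by blast
    qed
    have "C - ?T \<subset> C - T" using c y(2) by blast
    then have "card (C - ?T) < card (C - T)" using less.prems(1) by (simp add: psubset_card_mono)
    then show ?thesis
      using less.hyps[OF _ less.prems(1,2) T Tz z spanned] by blast
  qed
qed

section \<open>Bases of \<open>M_L D B0\<close> and separations with one finite side\<close>

lemma ground_M_L [simp]: "ground (M_L D B0) = verts D"
  by (simp add: ground_def M_L_def)

lemma indeps_M_L [simp]: "indeps (M_L D B0) = {I. linkable D B0 I}"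
  using linkable_subset_verts by (auto simp: indeps_def M_L_def)

lemma bases_M_L_iff:
  "B \<in> bases (M_L D B0) \<longleftrightarrow>
     linkable D B0 B \<and> (\<forall>z \<in> verts D - B. \<not> linkable D B0 (insert z B))"
proof
  assume "B \<in> bases (M_L D B0)"
  then show "linkable D B0 B \<and> (\<forall>z \<in> verts D - B. \<not> linkable D B0 (insert z B))"
    by (force simp: bases_def)
next
  assume *: "linkable D B0 B \<and> (\<forall>z \<in> verts D - B. \<not> linkable D B0 (insert z B))"
  have "I = B" if I: "linkable D B0 I" "B \<subseteq> I" for I
  proof (rule ccontr)
    assume "I \<noteq> B"
    then obtain z where "z \<in> I" "z \<notin> B" using I(2) by blast
    then show False
      using * I linkable_mono[OF I(1), of "insert z B"] linkable_subset_verts[OF I(1)] by blast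
  qed
  then show "B \<in> bases (M_L D B0)" using * by (simp add: bases_def)
qed

lemma bases_deletion_M_LD:
  assumes "B \<in> bases (deletion (M_L D B0) Y)"
  shows "linkable D B0 B" "B \<subseteq> verts D - Y"
    "\<And>z. z \<in> verts D - Y \<Longrightarrow> linkable D B0 (insert z B) \<Longrightarrow> z \<in> B"
proof -
  have B: "linkable D B0 B" "B \<subseteq> verts D - Y"
    "\<And>I. linkable D B0 I \<Longrightarrow> I \<subseteq> verts D - Y \<Longrightarrow> B \<subseteq> I \<Longrightarrow> I = B"
    using assms by (auto simp: bases_def deletion_def indeps_def[of "(_, _)"])
  then show "linkable D B0 B" "B \<subseteq> verts D - Y" by blast+
  show "z \<in> B" if "z \<in> verts D - Y" "linkable D B0 (insert z B)" for z
    using B(3)[OF that(2)] B(2) that(1) by blast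
qed

text \<open>Extending \<open>BY\<close> by a maximal \<open>A\<close> inside \<open>BX\<close> gives
  a base, at the cost of deleting \<open>BX - A\<close>. If this were all of \<open>G\<close>, then
  \<open>G = BX\<close> would be linkable and \<open>BY\<close> would be a base avoiding
  \<open>G\<close>, contrary to \<open>dep\<close>.\<close>

lemma finite_k_separation:
  assumes G: "finite G" "G \<subseteq> verts D" and inf: "infinite (verts D)"
    and dep: "\<not> linkable D B0 G \<or> (\<forall>B \<in> bases (M_L D B0). B \<inter> G \<noteq> {})"
  shows "k_separation (M_L D B0) (card G) G (verts D - G)"
proof -
  have "\<exists>F \<subseteq> BX \<union> BY. finite F \<and> card F < card G \<and> (BX \<union> BY) - F \<in> bases (M_L D B0)"
    if X: "BX \<in> bases (deletion (M_L D B0) (verts D - G))"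
      and Y: "BY \<in> bases (deletion (M_L D B0) G)" for BX BY
  proof -
    note X = bases_deletion_M_LD[OF X] and Y = bases_deletion_M_LD[OF Y]
    have BX: "BX \<subseteq> G" using X(2) by blast
    then have fin: "finite BX" using G(1) finite_subset by blast
    \<comment> \<open>As \<open>BX\<close> is finite, a maximal extension exists without any appeal
      to (IM).\<close>
    define ext where "ext = {A. A \<subseteq> BX \<and> linkable D B0 (BY \<union> A)}"
    have "finite ext" "ext \<noteq> {}"
      using fin Y(1) by (auto simp: ext_def intro!: exI[of _ "{}"])
    then obtain A where A: "A \<in> ext" and max: "\<And>A'. A' \<in> ext \<Longrightarrow> A \<subseteq> A' \<Longrightarrow> A' = A"
      using finite_has_maximal[of ext] by metis
    let ?T = "BY \<union> A"
    have T: "linkable D B0 ?T" and AX: "A \<subseteq> BX" using A by (auto simp: ext_def)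
    have spanned: "\<not> linkable D B0 (insert c ?T)" if "c \<in> BX - ?T" for c
      using max[of "insert c A"] that AX by (auto simp: ext_def)
    have base: "?T \<in> bases (M_L D B0)"
      unfolding bases_M_L_iff
    proof (intro conjI ballI notI)
      \<comment> \<open>By maximality of \<open>BY\<close> off \<open>G\<close>, such a
        \<open>z\<close> lies in \<open>G\<close>. Since \<open>?T\<close> spans \<open>BX\<close>
        but not \<open>z\<close>, transitivity makes \<open>insert z BX\<close> linkable, so
        \<open>z\<close> is in \<open>BX\<close> and hence spanned by \<open>?T\<close>.\<close>
      fix z assume z: "z \<in> verts D - ?T" "linkable D B0 (insert z ?T)"
      have "z \<in> G"
        using Y(3)[of z] z linkable_mono[OF z(2), of "insert z BY"] by blast
      moreover have "linkable D B0 (insert z BX)"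
        using linkable_insert_of_spanned[OF fin X(1) T z(2) _ spanned] z(1) by blast
      ultimately have "z \<in> BX" using X(3) z(1) by blast
      then show False using spanned z by blast
    qed (rule T)
    have disj: "BX \<inter> BY = {}" using BX Y(2) by blast
    then have "(BX \<union> BY) - (BX - A) = ?T" using AX by blast
    moreover have "BX - A \<noteq> G"
    proof
      assume "BX - A = G"
      then have "BX = G" "A = {}" using BX AX by blast+
      then show False using dep X(1) base Y(2) by auto
    qed
    then have "BX - A \<subset> G" using BX by blast
    then have "card (BX - A) < card G" using G(1) by (rule psubset_card_mono[rotated])
    ultimately show ?thesis
      using base fin by (intro exI[of _ "BX - A"]) auto
  qed
  then show ?thesis
    using G inf unfolding k_separation_def by (auto simp: Un_absorb1)
qed

end

section \<open>Constructing alternating combs\<close>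

text \<open>Lexicographic enumeration of infinitely many nonempty finite blocks, used to read a
  sequence of finite segments as a single ray.\<close>

lemma block_positions:
  fixes l :: "nat \<Rightarrow> nat"
  assumes pos_l: "\<And>k. 0 < l k"
  obtains pos where "inj pos" "range pos = {(k, i). i < l k}" "pos 0 = (0, 0)"
    "\<forall>n k i. pos n = (k, i) \<longrightarrow> pos (Suc n) = (if Suc i < l k then (k, Suc i) else (Suc k, 0))"
proof -
  define advance where "advance = (\<lambda>(k, i). if Suc i < l k then (k, Suc i) else (Suc k, 0 :: nat))"
  define pos where "pos n = (advance ^^ n) (0, 0)" for n
  have pos_0: "pos 0 = (0, 0)" by (simp add: pos_def)
  have pos_Suc: "pos (Suc n) = (if Suc i < l k then (k, Suc i) else (Suc k, 0))"
    if "pos n = (k, i)" for n k i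
    using that by (simp add: pos_def advance_def)
  \<comment> \<open>The index is the total length of the earlier blocks plus the offset, which
    determines it from the position.\<close>
  have inv: "i < l k \<and> n = sum l {..<k} + i" if "pos n = (k, i)" for n k i
    using that
  proof (induction n arbitrary: k i)
    case 0
    then show ?case using pos_0 pos_l by simp
  next
    case (Suc n)
    obtain k' i' where n: "pos n = (k', i')" by fastforce
    then show ?case using Suc.IH[OF n] Suc.prems pos_Suc[OF n] pos_l by (auto split: if_splits)
  qed
  have inj: "inj pos"
  proof (rule injI)
    fix m n assume "pos m = pos n"
    then show "m = n" using inv[of m "fst (pos n)" "snd (pos n)"] inv[of n "fst (pos n)" "snd (pos n)"] by simp
  qed
  have block: "(k, i) \<in> range pos" if "(k, 0) \<in> range pos" "i < l k" for k i
    using that(2)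
  proof (induction i)
    case (Suc i)
    then obtain n where "pos n = (k, i)" by auto
    from pos_Suc[OF this] Suc.prems show ?case by (metis rangeI)
  qed (use that in simp)
  have start: "(k, 0) \<in> range pos" for k
  proof (induction k)
    case 0
    show ?case using pos_0 by (metis rangeI)
  next
    case (Suc k)
    obtain n where "pos n = (k, l k - 1)" using block[OF Suc, of "l k - 1"] pos_l[of k] by auto
    from pos_Suc[OF this] pos_l[of k] show ?case by (metis Suc_diff_1 less_irrefl rangeI)
  qed
  have range: "range pos = {(k, i). i < l k}"
  proof (intro equalityI subsetI)
    fix x assume "x \<in> range pos"
    then obtain n where "pos n = x" by blast
    then show "x \<in> {(k, i). i < l k}" using inv[of n "fst x" "snd x"] by (simp add: case_prod_unfold)
  qed (use block start in auto)
  show thesis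
    using that[OF inj range pos_0] pos_Suc by blast
qed

section \<open>A criterion for containing an alternating comb\<close>

context sink_dimaze
begin

text \<open>\<open>W\<close> holds the indices of the valleys: the arc between \<open>r n\<close>
  and \<open>r (Suc n)\<close> points backwards exactly for \<open>n\<close> in \<open>W\<close>. As
  \<open>W\<close> has no two consecutive members and omits 0, both ray arcs at a valley point into
  it.\<close>

lemma contains_alternating_combI:
  assumes r: "inj r"
    and valleys: "infinite W" "0 \<notin> W" "\<And>n. n \<in> W \<Longrightarrow> Suc n \<notin> W"
    and forward: "\<And>n. n \<notin> W \<Longrightarrow> (r n, r (Suc n)) \<in> arcs_ends D"
    and backward: "\<And>n. n \<in> W \<Longrightarrow> (r (Suc n), r n) \<in> arcs_ends D"
    and Q: "linkage D B0 Q" "hd ` Q = insert (r 0) (r ` W)" "\<And>p. p \<in> Q \<Longrightarrow> set p \<inter> range r = {hd p}"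
  shows "contains_alternating_comb D B0"
proof -
  \<comment> \<open>One arc of \<open>D\<close> is chosen for each adjacent pair, so
    \<open>C\<close> has no parallel arcs even if \<open>D\<close> does.\<close>
  define arc_of where "arc_of = inv_into (arcs D) (arc_to_ends D)"
  have arc_of: "arc_of a \<in> arcs D" "arc_to_ends D (arc_of a) = a" if "a \<in> arcs_ends D" for a
    using that by (auto simp: arc_of_def arcs_ends_def inv_into_into f_inv_into_f)
  define ends where "ends n = (if n \<in> W then (r (Suc n), r n) else (r n, r (Suc n)))" for n
  define EQ where "EQ = (\<Union>p \<in> Q. set (vwalk_arcs p))"
  define R where "R = \<lparr>verts = range r, arcs = arc_of ` range ends, tail = tail D, head = head D\<rparr>"
  define C where "C = \<lparr>verts = range r \<union> (\<Union>p \<in> Q. set p), arcs = arc_of ` (range ends \<union> EQ),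
    tail = tail D, head = head D\<rparr>"
  have ends: "ends n \<in> arcs_ends D" for n
    using forward backward by (simp add: ends_def)
  have EQ: "a \<in> arcs_ends D" if "a \<in> EQ" for a
    using that Q(1) unfolding EQ_def linkage_def vpath_def vwalk_def by blast
  have sub: "range ends \<union> EQ \<subseteq> arcs_ends D"
    using ends EQ by blast
  have tail_head: "tail D (arc_of a) = fst a" "head D (arc_of a) = snd a" if "a \<in> arcs_ends D" for a
    using arc_of(2)[OF that] by (simp_all add: arc_to_ends_def prod_eq_iff)
  have ends_image: "(\<lambda>e. (tail D e, head D e)) ` arc_of ` A = A" if "A \<subseteq> arcs_ends D" for A
  proof -
    have "(\<lambda>e. (tail D e, head D e)) ` arc_of ` A = (\<lambda>a. a) ` A"
      unfolding image_image using that tail_head by (intro image_cong) auto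
    then show ?thesis by simp
  qed
  have arcs_R: "arcs_ends R = range ends" and arcs_C: "arcs_ends C = range ends \<union> EQ"
    using ends_image[of "range ends"] ends_image[OF sub] sub by (simp_all add: R_def C_def arcs_ends_conv)
  have ends_verts: "fst (ends n) \<in> range r" "snd (ends n) \<in> range r" for n
    by (simp_all add: ends_def)
  have wf_R: "wf_digraph R"
    using tail_head[OF ends] ends_verts by unfold_locales (auto simp: R_def)
  have EQ_verts: "fst a \<in> (\<Union>p \<in> Q. set p)" "snd a \<in> (\<Union>p \<in> Q. set p)" if "a \<in> EQ" for a
    using that unfolding EQ_def set_vwalk_arcs by (force dest: Suc_lessD intro: nth_mem)+
  have wf_C: "wf_digraph C"
    using tail_head[OF ends] tail_head[OF EQ] EQ_verts ends_verts by unfold_locales (auto simp: C_def)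
  have R_C: "subgraph R C"
    using wf_R wf_C by (auto simp: subgraph_def R_def C_def compatible_def)
  have Q_verts: "set p \<subseteq> verts D" if "p \<in> Q" for p
    using linkageD(3)[OF Q(1) that] .
  have C_D: "subgraph C D"
  proof -
    have "arc_of ` (range ends \<union> EQ) \<subseteq> arcs D"
      using sub arc_of(1) by blast
    moreover have "range r \<subseteq> verts D"
      using forward backward arc_verts by blast
    ultimately show ?thesis
      using Q_verts wf_C wf by (auto simp: subgraph_def C_def compatible_def)
  qed
  have inj_e: "inj (\<lambda>n. arc_of (ends n))"
  proof (rule injI)
    fix m n assume "arc_of (ends m) = arc_of (ends n)"
    then have "ends m = ends n" using arc_of(2)[OF ends] by metis
    then show "m = n" using inj_eq[OF r] by (auto simp: ends_def split: if_splits)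
  qed
  have degree: "in_degree R (r n) = 2 \<longleftrightarrow> n \<in> W" for n
  proof -
    have "head D (arc_of (ends m)) = r n \<longleftrightarrow> m = n \<and> m \<in> W \<or> Suc m = n \<and> m \<notin> W" for m
      unfolding tail_head(2)[OF ends] by (auto simp: ends_def inj_eq[OF r])
    then have "in_arcs R (r n) = (\<lambda>n. arc_of (ends n)) ` {m. m = n \<and> m \<in> W \<or> Suc m = n \<and> m \<notin> W}" (is "_ = _ ` ?N")
      by (auto simp: in_arcs_def R_def)
    then have "in_degree R (r n) = card ?N"
      using inj_e by (simp add: in_degree_def card_image inj_on_subset)
    moreover have "card ?N = 2" if n: "n \<in> W"
    proof -
      obtain m where m: "n = Suc m" using n valleys(2) by (cases n) auto
      then have "?N = {m, n}" using n valleys(3)[of m] by auto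
      then show ?thesis using m by simp
    qed
    moreover have "card ?N \<noteq> 2" if "n \<notin> W"
    proof -
      \<comment> \<open>For \<open>n = 0\<close> the set \<open>?N\<close> is empty, so the
        truncated subtraction is harmless.\<close>
      have "?N \<subseteq> {n - 1}" using that by auto
      then have "card ?N \<le> card {n - 1}" by (intro card_mono) auto
      then show ?thesis by simp
    qed
    ultimately show ?thesis by metis
  qed
  then have degree_set: "{v \<in> verts R. in_degree R v = 2} = r ` W"
    by (auto simp: R_def)
  have "alternating_ray R r"
    unfolding alternating_ray_def
  proof (intro conjI exI allI)
    show "bij_betw r UNIV (verts R)" using r by (simp add: R_def bij_betw_def)
    show "bij_betw (\<lambda>n. arc_of (ends n)) UNIV (arcs R)"
      using inj_e by (auto simp: R_def bij_betw_def)
    show "{tail R (arc_of (ends n)), head R (arc_of (ends n))} = {r n, r (Suc n)}" for n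
      using tail_head[OF ends] by (auto simp: R_def ends_def)
    show "infinite {v \<in> verts R. in_degree R v = 2}"
      using valleys(1) r unfolding degree_set by (meson finite_imageD inj_on_subset subset_UNIV)
  qed (rule wf_R)
  moreover have "dimaze C (last ` Q)"
  proof -
    have "last p \<in> B0" "last p \<in> verts C" if "p \<in> Q" for p
      using linkageD(4)[OF Q(1) that] last_in_set[OF linkageD(1)[OF Q(1) that]] that
      by (auto simp: C_def)
    moreover have "out_arcs C v = {}" if "v \<in> B0" for v
    proof -
      have "out_arcs D v = {}" using that dimaze by (auto simp: dimaze_def)
      moreover have "out_arcs C v \<subseteq> out_arcs D v"
        using sub arc_of(1) by (auto simp: out_arcs_def C_def)
      ultimately show ?thesis by blast
    qed
    ultimately show ?thesis using wf_C by (auto simp: dimaze_def)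
  qed
  moreover have "nomulti_digraph C"
  proof -
    have "e1 = e2" if e: "e1 \<in> arcs C" "e2 \<in> arcs C" "arc_to_ends C e1 = arc_to_ends C e2" for e1 e2
    proof -
      have "arcs C \<subseteq> arc_of ` arcs_ends D"
        using image_mono[OF sub, of arc_of] by (simp add: C_def)
      then obtain a1 a2 where a: "e1 = arc_of a1" "e2 = arc_of a2" "a1 \<in> arcs_ends D" "a2 \<in> arcs_ends D"
        using e(1,2) by blast
      have "arc_to_ends D e1 = arc_to_ends D e2"
        using e(3) by (simp add: arc_to_ends_def C_def)
      then show ?thesis using a arc_of(2) by metis
    qed
    then show ?thesis using wf_C by (simp add: nomulti_digraph_def nomulti_digraph_axioms_def)
  qed
  moreover have "linkage C (last ` Q) Q"
  proof -
    have "vpath p C" if p: "p \<in> Q" for p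
    proof -
      have "set p \<subseteq> verts C" "set (vwalk_arcs p) \<subseteq> arcs_ends C"
        using p unfolding arcs_C by (auto simp: C_def EQ_def)
      then show ?thesis using linkageD(1,2)[OF Q(1) p] by (simp add: vpath_def vwalk_def)
    qed
    then show ?thesis using Q(1) by (auto simp: linkage_def)
  qed
  moreover have "verts C = verts R \<union> (\<Union>p \<in> Q. set p)" "\<forall>p \<in> Q. set p \<inter> verts R = {hd p}"
    using Q(3) by (auto simp: C_def R_def)
  ultimately have "alternating_comb C (last ` Q)"
    unfolding alternating_comb_def
    using R_C Q(2) arcs_R arcs_C
    by (intro conjI exI[of _ R] exI[of _ r] exI[of _ Q]) (simp_all add: degree_set EQ_def)
  moreover have "last ` Q \<subseteq> B0" using linkageD(4)[OF Q(1)] by blast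
  ultimately show ?thesis
    using C_D unfolding contains_alternating_comb_def by blast
qed

text \<open>An exit off all paths could be added as a trivial path, so by maximality it would belong
  to \<open>B\<close> and start a path after all. An exit on a path is its last vertex, having no
  outgoing arc.\<close>

lemma base_linkage_onto:
  assumes B: "B \<in> bases (M_L D B0)" and P: "linkage D B0 P" "hd ` P = B"
  shows "B0 \<subseteq> last ` P"
proof
  fix b assume b: "b \<in> B0"
  have "\<exists>p \<in> P. b \<in> set p"
  proof (rule ccontr)
    assume *: "\<not> ?thesis"
    have "vpath [b] D" using b exits_subset by (auto simp: vpath_def vwalk_def)
    then have "linkage D B0 (insert [b] P)" using * P(1) b by (auto simp: linkage_def)
    moreover have "hd ` insert [b] P = insert b B" using P(2) by simp
    ultimately have "linkable D B0 (insert b B)" unfolding linkable_def by blast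
    then have "b \<in> B" using B b exits_subset by (auto simp: bases_M_L_iff)
    then show False using * P(2) linkageD(1)[OF P(1)] by (metis hd_in_set imageE)
  qed
  then obtain p where p: "p \<in> P" "b \<in> set p" by blast
  then obtain i where i: "i < length p" "b = p ! i" by (metis in_set_conv_nth)
  have "\<not> Suc i < length p"
    using linkageD(5)[OF P(1) p(1)] arc_verts b i(2) by blast
  then have "b = last p" using i by (metis Suc_lessI diff_Suc_1 last_conv_nth list.size(3) not_less0)
  then show "b \<in> last ` P" using p(1) by blast
qed

definition exit_path :: "'a list \<Rightarrow> 'a \<Rightarrow> 'a set \<Rightarrow> bool" where
  "exit_path p v S \<longleftrightarrow> vpath p D \<and> hd p = v \<and> last p \<in> B0 \<and> set p \<inter> S = {}"

lemma exit_pathD: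
  assumes "exit_path p v S"
  shows "p \<noteq> []" "distinct p" "set p \<subseteq> verts D" "hd p = v" "last p \<in> B0" "set p \<inter> S = {}"
    "v \<in> set p" "\<And>i. Suc i < length p \<Longrightarrow> (p ! i, p ! Suc i) \<in> arcs_ends D"
  using assms by (auto simp: exit_path_def vpath_def vwalk_def set_vwalk_arcs)

end

section \<open>Greedy construction of a comb under high connectivity\<close>

locale highly_connected_dimaze = sink_dimaze +
  assumes finite_linkable: "\<And>G. finite G \<Longrightarrow> G \<subseteq> verts D \<Longrightarrow> linkable D B0 G"
    and finite_avoidable: "\<And>G. finite G \<Longrightarrow> G \<subseteq> verts D \<Longrightarrow> \<exists>B \<in> bases (M_L D B0). B \<inter> G = {}"
begin

text \<open>In a linkage of \<open>v\<close> together with \<open>S\<close>, every vertex of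
  \<open>S\<close> starts its own path, so the path from \<open>v\<close> avoids
  \<open>S\<close>.\<close>

lemma exit_path_exists:
  assumes "v \<in> verts D" "finite S" "v \<notin> S"
  obtains p where "exit_path p v S"
proof -
  have "linkable D B0 (insert v (S \<inter> verts D))"
    using finite_linkable assms by simp
  then obtain P where P: "linkage D B0 P" "hd ` P = insert v (S \<inter> verts D)"
    by (auto simp: linkable_def)
  then obtain p where p: "p \<in> P" "hd p = v" by (metis imageE insertI1)
  have "s \<notin> set p" if s: "s \<in> S" for s
  proof
    assume "s \<in> set p"
    then have "s \<in> hd ` P" using P linkageD(3)[OF P(1) p(1)] s by auto
    then obtain q where q: "q \<in> P" "hd q = s" by blast
    then have "s \<in> set q" using linkageD(1)[OF P(1)] hd_in_set by metis
    then have "p = q" using linkage_disjoint[OF P(1) p(1) q(1)] \<open>s \<in> set p\<close> by blast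
    then show False using p q s assms(3) by simp
  qed
  then show thesis
    using that[of p] P(1) p by (auto simp: exit_path_def linkage_def)
qed

text \<open>If only finitely many exits were reachable, they could be added to the forbidden set,
  and \<open>exit_path_exists\<close> would reach a further one.\<close>

lemma infinite_reachable_exits:
  assumes "v \<in> inner" "finite S" "v \<notin> S"
  shows "infinite {last p | p. exit_path p v S}"
proof
  let ?E = "{last p | p. exit_path p v S}"
  assume "finite ?E"
  moreover have "v \<notin> ?E" using assms(1) by (auto simp: exit_path_def)
  ultimately obtain p where p: "exit_path p v (S \<union> ?E)"
    using exit_path_exists[of v "S \<union> ?E"] assms by auto
  then have "exit_path p v S" "last p \<notin> ?E"
    using exit_pathD[OF p] p last_in_set[of p] unfolding exit_path_def by blast+
  then show False by blast
qed

text \<open>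
  The union \<open>H\<close> of more than \<open>card S + 1\<close> paths from \<open>v\<close> to distinct exits is finite, so these
  exits are also the ends of disjoint paths starting outside \<open>H\<close>. One of them avoids
  \<open>insert v S\<close>; its first vertex in \<open>H\<close> is the new valley.
\<close>
lemma next_valley:
  assumes v: "v \<in> inner" and S: "finite S" "v \<notin> S"
  shows "\<exists>as bs u. exit_path (as @ bs) v S \<and> as \<noteq> [] \<and> bs \<noteq> [] \<and> u \<in> inner \<and>
    u \<notin> S \<union> set (as @ bs) \<and> (u, hd bs) \<in> arcs_ends D"
proof -
  \<comment> \<open>The size exceeds that of \<open>insert v S\<close> by one, so disjoint paths to
    these exits cannot all meet that set.\<close>
  obtain E where E: "E \<subseteq> {last p | p. exit_path p v S}" "finite E" "card E = card S + 2"
    using infinite_arbitrarily_large[OF infinite_reachable_exits[OF assms]] by blast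
  then have "\<forall>b \<in> E. \<exists>p. exit_path p v S \<and> last p = b" by blast
  then obtain \<phi> where \<phi>: "\<And>b. b \<in> E \<Longrightarrow> exit_path (\<phi> b) v S" "\<And>b. b \<in> E \<Longrightarrow> last (\<phi> b) = b"
    by metis
  define H where "H = (\<Union>b \<in> E. set (\<phi> b))"
  have "finite H" "H \<subseteq> verts D"
    using E(2) exit_pathD(3)[OF \<phi>(1)] by (auto simp: H_def)
  then obtain B where B: "B \<in> bases (M_L D B0)" "B \<inter> H = {}"
    using finite_avoidable by blast
  obtain P where P: "linkage D B0 P" "hd ` P = B"
    using B(1) by (auto simp: bases_M_L_iff linkable_def)
  have "\<exists>q \<in> P. last q = b" if "b \<in> E" for b
    using base_linkage_onto[OF B(1) P] \<phi>[OF that] by (auto simp: exit_path_def)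
  then obtain q where q: "\<And>b. b \<in> E \<Longrightarrow> q b \<in> P" "\<And>b. b \<in> E \<Longrightarrow> last (q b) = b"
    by metis
  have "\<exists>b \<in> E. set (q b) \<inter> insert v S = {}"
  proof (rule ccontr)
    assume "\<not> ?thesis"
    then have "\<forall>b \<in> E. \<exists>s. s \<in> set (q b) \<and> s \<in> insert v S" by blast
    then obtain s where s: "\<And>b. b \<in> E \<Longrightarrow> s b \<in> set (q b)" "\<And>b. b \<in> E \<Longrightarrow> s b \<in> insert v S"
      by metis
    have "inj_on s E"
      using linkage_disjoint[OF P(1)] s(1) q by (metis inj_onI)
    then have "card E \<le> card (insert v S)"
      using s(2) S(1) by (intro card_inj_on_le[of s]) auto
    then show False using E(3) S by simp
  qed
  then obtain b where b: "b \<in> E" "set (q b) \<inter> insert v S = {}" by blast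
  note qb = linkageD[OF P(1) q(1)[OF b(1)]]
  have "b \<in> set (q b)" using last_in_set[OF qb(1)] q(2)[OF b(1)] by simp
  moreover have "b \<in> H"
    using \<phi>(2)[OF b(1)] b(1) last_in_set[OF exit_pathD(1)[OF \<phi>(1)[OF b(1)]]] by (auto simp: H_def)
  \<comment> \<open>The path starts in \<open>B\<close>, hence outside \<open>H\<close>, so its
    first vertex \<open>y\<close> in \<open>H\<close> has a predecessor; this is the new vertex
    \<open>u\<close>.\<close>
  ultimately obtain ys y zs where split: "q b = ys @ y # zs" "y \<in> H" "\<forall>x \<in> set ys. x \<notin> H"
    using split_list_first_prop[of "q b" "\<lambda>x. x \<in> H"] by blast
  have "hd (q b) \<in> B" using P(2) q(1)[OF b(1)] by blast
  then have ys: "ys \<noteq> []" using split B(2) by auto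
  obtain b' where b': "b' \<in> E" "y \<in> set (\<phi> b')" using split(2) by (auto simp: H_def)
  then obtain as cs where \<phi>b': "\<phi> b' = as @ y # cs" by (meson split_list)
  have "y \<noteq> v" using b(2) split(1) by auto
  then have as: "as \<noteq> []" using \<phi>(1)[OF b'(1)] \<phi>b' by (auto simp: exit_path_def)
  have u: "last ys \<in> set ys" using ys by simp
  have "(last ys, y) \<in> set (vwalk_arcs (q b))"
    using ys unfolding split(1) by (simp add: vwalk_arcs_append)
  then have arc: "(last ys, y) \<in> arcs_ends D"
    using P(1) q(1)[OF b(1)] by (auto simp: linkage_def vpath_def vwalk_def)
  have "last ys \<notin> S \<union> set (as @ y # cs)"
    using u split(1,3) b(2) b'(1) H_def \<phi>b'[symmetric] by auto
  then show ?thesis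
    using \<phi>(1)[OF b'(1)] \<phi>b' as arc arc_verts[OF arc]
    by (intro exI[of _ as] exI[of _ "y # cs"] exI[of _ "last ys"]) auto
qed

text \<open>A base avoiding an exit is linked onto that exit by a nontrivial path, and such a path
  starts at a nonexit.\<close>

lemma inner_nonempty:
  assumes "verts D \<noteq> {}"
  shows "inner \<noteq> {}"
proof
  assume "inner = {}"
  then have V: "verts D = B0" using exits_subset by blast
  obtain v where v: "v \<in> verts D" using assms by blast
  obtain B where B: "B \<in> bases (M_L D B0)" "B \<inter> {v} = {}"
    using finite_avoidable[of "{v}"] v by auto
  then obtain P where P: "linkage D B0 P" "hd ` P = B"
    by (auto simp: bases_M_L_iff linkable_def)
  then obtain p where p: "p \<in> P" "last p = v"
    using base_linkage_onto[OF B(1) P] v V by auto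
  have "hd p \<noteq> v" using P(2) p(1) B(2) by auto
  then have "Suc 0 < length p"
    using linkageD(1)[OF P(1) p(1)] p(2) by (cases p) (auto split: if_splits)
  then show False
    using linkageD(5)[OF P(1) p(1)] arc_verts \<open>inner = {}\<close> by blast
qed

lemma comb_exists:
  assumes "verts D \<noteq> {}"
  shows "contains_alternating_comb D B0"
proof -
  obtain v0 where v0: "v0 \<in> inner" using inner_nonempty[OF assms] by blast
  obtain p0 where p0: "exit_path p0 v0 {}" using exit_path_exists[of v0 "{}"] v0 by auto
  obtain A B U where step: "\<And>v S. v \<in> inner \<Longrightarrow> finite S \<Longrightarrow> v \<notin> S \<Longrightarrow>
      exit_path (A v S @ B v S) v S \<and> A v S \<noteq> [] \<and> B v S \<noteq> [] \<and> U v S \<in> inner \<and>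
      U v S \<notin> S \<union> set (A v S @ B v S) \<and> (U v S, hd (B v S)) \<in> arcs_ends D"
    using next_valley by metis
  \<comment> \<open>A state consists of the current end of the ray and the set of forbidden
    vertices. The start \<open>v0\<close> is left out of the initial forbidden set, since the first
    path begins there; \<open>p0\<close> is the linking path of \<open>v0\<close>.\<close>
  define st where "st = rec_nat (v0, set p0 - {v0}) (\<lambda>_ (v, S). (U v S, S \<union> set (A v S @ B v S)))"
  define v S where "v k = fst (st k)" and "S k = snd (st k)" for k
  define a b where "a k = A (v k) (S k)" and "b k = B (v k) (S k)" for k
  have v_0: "v 0 = v0" and S_0: "S 0 = set p0 - {v0}"
    by (simp_all add: v_def S_def st_def)
  have v_Suc: "v (Suc k) = U (v k) (S k)" and S_Suc: "S (Suc k) = S k \<union> set (a k @ b k)" for k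
    by (simp_all add: v_def S_def a_def b_def st_def case_prod_unfold)
  have inv: "v k \<in> inner \<and> finite (S k) \<and> v k \<notin> S k" for k
  proof (induction k)
    case (Suc k)
    then show ?case using step[of "v k" "S k"] by (simp add: v_Suc S_Suc a_def b_def)
  qed (use v0 in \<open>simp add: v_0 S_0\<close>)
  have path: "exit_path (a k @ b k) (v k) (S k)" and nonempty: "a k \<noteq> []" "b k \<noteq> []"
    and backward: "(v (Suc k), hd (b k)) \<in> arcs_ends D" for k
    using step[of "v k" "S k"] inv[of k] unfolding a_def b_def v_Suc by blast+
  have S_mono: "S j \<subseteq> S k" if "j \<le> k" for j k
    using that by (induction rule: dec_induct) (auto simp: S_Suc)
  have disjoint_less: "set (a j @ b j) \<inter> set (a k @ b k) = {}" if "j < k" for j k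
    using S_mono[of "Suc j" k] that exit_pathD(6)[OF path[of k]] by (auto simp: S_Suc)
  then have disjoint: "j = k" if "x \<in> set (a j @ b j)" "x \<in> set (a k @ b k)" for x j k
    using that by (metis disjoint_iff linorder_neqE_nat)
  have v0_mem: "k = 0" if "v0 \<in> set (a k @ b k)" for k
    using disjoint[of v0 k 0] that exit_pathD(7)[OF path[of 0]] v_0 by simp
  have p0_disjoint: "x = v0" if "x \<in> set p0" "x \<in> set (a k @ b k)" for x k
    using that S_mono[of 0 k] exit_pathD(6)[OF path[of k]] S_0 by auto
  have hd_a: "hd (a k) = v k" for k
    using exit_pathD(4)[OF path[of k]] nonempty(1) by simp
  \<comment> \<open>The ray segment of stage \<open>k\<close> ends with the valley
    \<open>hd (b k)\<close>, where the linking path \<open>b k\<close> begins. The next segment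
    starts at \<open>v (Suc k)\<close>, whose arc points back to this valley.\<close>
  define c where "c k = a k @ [hd (b k)]" for k
  have len_c: "1 < length (c k)" for k using nonempty(1) by (simp add: c_def)
  have set_c: "set (c k) \<subseteq> set (a k @ b k)" for k using nonempty(2) by (auto simp: c_def)
  have nth_c: "c k ! i = (a k @ b k) ! i" if "i < length (c k)" for k i
    using that nonempty(2)[of k] by (auto simp: c_def nth_append hd_conv_nth less_Suc_eq)
  have distinct_c: "distinct (c k)" for k
    using exit_pathD(2)[OF path[of k]] nonempty(2)[of k] by (auto simp: c_def)
  have "0 < length (c k)" for k by (simp add: c_def)
  then obtain pos where pos: "inj pos" "range pos = {(k, i). i < length (c k)}" "pos 0 = (0, 0)"
    "\<forall>n k i. pos n = (k, i) \<longrightarrow> pos (Suc n) = (if Suc i < length (c k) then (k, Suc i) else (Suc k, 0))"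
    by (rule block_positions[of "\<lambda>k. length (c k)"])
  define r where "r n = c (fst (pos n)) ! snd (pos n)" for n
  have pos_len: "i < length (c k)" if "pos n = (k, i)" for n k i
  proof -
    have "(k, i) \<in> range pos" using that by (metis rangeI)
    then show ?thesis using pos(2) by simp
  qed
  have r_pos: "r n = c k ! i" if "pos n = (k, i)" for n k i
    using that by (simp add: r_def)
  have r_mem: "r n \<in> set (c k)" if "pos n = (k, i)" for n k i
    using r_pos[OF that] pos_len[OF that] by simp
  have c_range: "set (c k) \<subseteq> range r" for k
  proof
    fix x assume "x \<in> set (c k)"
    then obtain i where i: "i < length (c k)" "x = c k ! i" by (metis in_set_conv_nth)
    then have "(k, i) \<in> range pos" using pos(2) by blast
    then obtain n where "pos n = (k, i)" by force
    then have "x = r n" using r_pos i(2) by simp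
    then show "x \<in> range r" by simp
  qed
  have range_r: "\<exists>k. x \<in> set (c k)" if "x \<in> range r" for x
    using that r_mem by (metis rangeE surj_pair)
  have inj_r: "inj r"
  proof (rule injI)
    fix m n assume eq: "r m = r n"
    obtain k i k' i' where k: "pos m = (k, i)" "pos n = (k', i')" by (metis surj_pair)
    have "k = k'" using disjoint[of "r m" k k'] r_mem[OF k(1)] r_mem[OF k(2)] set_c eq by auto
    moreover have "i = i'"
      using distinct_c[of k] r_pos[OF k(1)] r_pos[OF k(2)] eq pos_len[OF k(1)] pos_len[OF k(2)] calculation
      by (simp add: nth_eq_iff_index_eq)
    ultimately show "m = n" using k pos(1) by (metis injD)
  qed
  \<comment> \<open>The last positions of the segments, that is, the valleys. Every segment has at
    least two vertices, so no valley comes first or directly after another.\<close>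
  define W where "W = {n. Suc (snd (pos n)) = length (c (fst (pos n)))}"
  have W_iff: "n \<in> W \<longleftrightarrow> Suc i = length (c k)" if "pos n = (k, i)" for n k i
    using that by (simp add: W_def)
  have r_W: "r n = hd (b k)" if "n \<in> W" "pos n = (k, i)" for n k i
    using that W_iff[OF that(2)] r_pos[OF that(2)] by (simp add: c_def)
  have image_W: "r ` W = range (\<lambda>k. hd (b k))"
  proof (intro equalityI subsetI)
    fix x assume "x \<in> r ` W"
    then show "x \<in> range (\<lambda>k. hd (b k))" using r_W by (metis imageE rangeI surj_pair)
  next
    fix x assume "x \<in> range (\<lambda>k. hd (b k))"
    then obtain k where k: "x = hd (b k)" by blast
    have "(k, length (c k) - 1) \<in> range pos" using len_c[of k] pos(2) by auto
    then obtain n where n: "pos n = (k, length (c k) - 1)" by force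
    then have "n \<in> W" using W_iff[OF n] len_c[of k] by simp
    then show "x \<in> r ` W" using r_W[OF _ n] k by (metis image_eqI)
  qed
  have hd_b_mem: "hd (b k) \<in> set (b k)" for k using nonempty(2) by simp
  have "inj (\<lambda>k. hd (b k))"
  proof (rule injI)
    fix j k assume "hd (b j) = hd (b k)"
    then show "j = k" using disjoint[of "hd (b j)" j k] hd_b_mem[of j] hd_b_mem[of k] by simp
  qed
  then have "infinite (r ` W)"
    unfolding image_W by (rule range_inj_infinite)
  then have "infinite W" by blast
  moreover have "0 \<notin> W" using W_iff[OF pos(3)] len_c[of 0] by simp
  moreover have "Suc n \<notin> W" if "n \<in> W" for n
  proof -
    obtain k i where k: "pos n = (k, i)" by fastforce
    then have "pos (Suc n) = (Suc k, 0)" using pos(4)[rule_format, OF k] W_iff[OF k] that by simp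
    then show ?thesis using W_iff[of "Suc n" "Suc k" 0] len_c[of "Suc k"] by simp
  qed
  moreover have "(r n, r (Suc n)) \<in> arcs_ends D" if "n \<notin> W" for n
  proof -
    obtain k i where k: "pos n = (k, i)" by fastforce
    have i: "Suc i < length (c k)" using W_iff[OF k] pos_len[OF k] that by simp
    then have "r (Suc n) = c k ! Suc i" using pos(4)[rule_format, OF k] r_pos by simp
    moreover have "Suc i < length (a k @ b k)" using i nonempty(2)[of k] by (cases "b k") (auto simp: c_def)
    ultimately show ?thesis
      using r_pos[OF k] i nth_c exit_pathD(8)[OF path[of k]] by simp
  qed
  moreover have "(r (Suc n), r n) \<in> arcs_ends D" if "n \<in> W" for n
  proof -
    obtain k i where k: "pos n = (k, i)" by fastforce
    then have "pos (Suc n) = (Suc k, 0)" using pos(4)[rule_format, OF k] W_iff[OF k] that by simp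
    then have "r (Suc n) = c (Suc k) ! 0" by (rule r_pos)
    also have "\<dots> = v (Suc k)"
      using nonempty(1)[of "Suc k"] hd_a[of "Suc k"] by (simp add: c_def nth_append hd_conv_nth)
    finally show ?thesis using backward[of k] r_W[OF that k] by simp
  qed
  moreover have "linkage D B0 (insert p0 (range b))"
  proof -
    have "vpath (b k) D" "last (b k) \<in> B0" for k
    proof -
      have "set (vwalk_arcs (b k)) \<subseteq> set (vwalk_arcs (a k @ b k))"
        by (rule set_vwalk_arcs_append2)
      then show "vpath (b k) D" "last (b k) \<in> B0"
        using path[of k] nonempty(2)[of k] by (auto simp: exit_path_def vpath_def vwalk_def)
    qed
    moreover have "set (b j) \<inter> set (b k) = {}" if "b j \<noteq> b k" for j k
      using disjoint[of _ j k] that by auto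
    \<comment> \<open>\<open>p0\<close> can meet stage \<open>k\<close> only in \<open>v0\<close>,
      which occurs only as the head of \<open>a 0\<close>.\<close>
    moreover have "set p0 \<inter> set (b k) = {}" for k
    proof -
      have "v0 \<notin> set (b k)"
      proof
        assume *: "v0 \<in> set (b k)"
        then have "k = 0" using v0_mem[of k] by simp
        then have "v0 \<in> set (a k)" using hd_a[of k] v_0 nonempty(1)[of k] hd_in_set by metis
        then show False using * exit_pathD(2)[OF path[of k]] by auto
      qed
      then show ?thesis using p0_disjoint[of _ k] by auto
    qed
    ultimately show ?thesis
      using p0 unfolding linkage_def exit_path_def by (auto simp: Int_commute)
  qed
  moreover have r_0: "r 0 = v0"
    using r_pos[OF pos(3)] hd_a[of 0] v_0 nonempty(1)[of 0] by (simp add: c_def nth_append hd_conv_nth)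
  moreover have hd_Q: "hd ` insert p0 (range b) = insert (r 0) (r ` W)"
    using exit_pathD(4)[OF p0] r_0 by (auto simp: image_W)
  moreover have "set p \<inter> range r = {hd p}" if p: "p \<in> insert p0 (range b)" for p
  proof
    have "hd p \<in> set p" using p exit_pathD(1)[OF p0] nonempty(2) by auto
    moreover have "hd p \<in> range r"
      using hd_Q p by blast
    ultimately show "{hd p} \<subseteq> set p \<inter> range r" by blast
    show "set p \<inter> range r \<subseteq> {hd p}"
    proof
      fix x assume x: "x \<in> set p \<inter> range r"
      then obtain k where k: "x \<in> set (c k)" using range_r by blast
      consider "p = p0" | j where "p = b j" using p by blast
      then show "x \<in> {hd p}"
      proof cases
        case 1
        then show ?thesis using p0_disjoint[of x k] x k set_c exit_pathD(4)[OF p0] by auto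
      next
        case 2
        then have "j = k" using disjoint[of x j k] x k set_c by auto
        then show ?thesis
          using 2 x k exit_pathD(2)[OF path[of k]] by (auto simp: c_def)
      qed
    qed
  qed
  ultimately show ?thesis
    by (intro contains_alternating_combI[of r W "insert p0 (range b)"] inj_r)
qed

end

theorem corollary3p2:
  fixes D :: "('a, 'b) pre_digraph" and B0 :: "'a set"
  assumes "dimaze D B0"
    and "infinite (verts D)"
    and "\<not> contains_alternating_comb D B0"
  shows "\<not> infinitely_connected (M_L D B0)"
proof
  assume "infinitely_connected (M_L D B0)"
  interpret sink_dimaze D B0 by unfold_locales (rule assms(1))
  have *: "linkable D B0 G \<and> (\<exists>B \<in> bases (M_L D B0). B \<inter> G = {})"
    if G: "finite G" "G \<subseteq> verts D" for G
  proof (rule ccontr)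
    assume "\<not> ?thesis"
    then have "k_separation (M_L D B0) (card G) G (verts D - G)"
      by (intro finite_k_separation[OF G assms(2)]) blast
    then show False
      using \<open>infinitely_connected (M_L D B0)\<close> unfolding infinitely_connected_def by blast
  qed
  interpret highly_connected_dimaze D B0 by unfold_locales (simp_all add: *)
  have "verts D \<noteq> {}" using assms(2) by auto
  then show False using comb_exists assms(3) by blast
qed

end
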